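(* Let $Q$ be a finite alphabet of size $q \ge 2$, $Z$ a countable set, and $\pi_q = \mathrm{lcm}(1,2,\dots,q)$. For a network $f : Q^Z \to Q^Z$ and $s \subseteq Z$, let $f^{(s)}(x) = (f_s(x), x_{Z \setminus s})$ and $f^{(s_1,\dots,s_k)} = f^{(s_k)} \circ \dots \circ f^{(s_1)}$. Call $f$ locally commutative if $f^{(i,j)} = f^{(j,i)}$ for all $i,j \in Z$, and globally commutative if $f^{(s,t)} = f^{(t,s)}$ for all $s,t \subseteq Z$. Consider the properties: (ICi) $f^{(i,j)} = f^{(\{i,j\})}$ for all $i,j \in Z$; (ICb) $f^{(b,c)} = f^{(b \cup c)}$ for all finite $b,c \subseteq Z$; (ICs) $f^{(s,t)} = f^{(s \cup t)}$ for all $s,t \subseteq Z$; (I) $f \circ f = f$; (Ii) $f^{(i)} \circ f^{(i)} = f^{(i)}$ for all $i \in Z$; (Ib) $f^{(b)} \circ f^{(b)} = f^{(b)}$ for all finite $b \subseteq Z$; (Is) $f^{(s)} \circ f^{(s)} = f^{(s)}$ for all $s \subseteq Z$; (D) $f^{\pi_q + q - 1} = f^{q-1}$; (Ds) $(f^{(s)})^{\pi_q + q - 1} = (f^{(s)})^{q-1}$ for all $s \subseteq Z$. Then: (1) for globally commutative $f$, (I) $\iff$ (Ii) $\iff$ (Is) $\iff$ (ICs); (2) for locally commutative $f$, (Ii) $\iff$ (ICi) $\iff$ (Ib) $\iff$ (ICb); (3) there exists a locally commutative network satisfying (Ii) but not (D); (4) there exists a locally commutative network satisfying (I) and (Ds)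 but not (Ii); (5) there exists a locally commutative network satisfying (Ii) and (I) but not (Ds); (6) there exists a locally commutative network satisfying (Ii) and (Ds) but not (I); (7) there exists a locally commutative network satisfying (Is) that is not globally commutative.
   Context: Automata networks $f: Q^Z \to Q^Z$ with $Q$ finite and $Z$ countable; $x_s$ denotes the restriction of $x$ to $s$.
   Formalization: In (3)–(7) the set Z is taken to be countably infinite (every such Z and every q ≥ 2 is covered); for finite Z these claims fail, since local commutativity then implies global commutativity and (1) applies. *)

theory Defs
  imports Main "HOL-Library.Countable" "HOL-Library.Cardinality"
begin

text \<open>
  The alphabet \<open>Q\<close> is the type \<open>'q\<close> (of class \<open>finite\<close>), the index set \<open>Z\<close> is the
  type \<open>'z\<close> (of class \<open>countable\<close>, so either finite or countably infinite), and
  \<open>Q\<^sup>Z\<close> is \<open>'z \<Rightarrow> 'q\<close>.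
\<close>

type_synonym ('z, 'q) network = "('z \<Rightarrow> 'q) \<Rightarrow> ('z \<Rightarrow> 'q)"

definition update :: "('z, 'q) network \<Rightarrow> 'z set \<Rightarrow> ('z, 'q) network" where
  "update f s = (\<lambda>x. override_on x (f x) s)"

text \<open>The leftmost set of the list is updated first:
  \<open>updates f [s\<^sub>1, \<dots>, s\<^sub>k] = update f s\<^sub>k \<circ> \<dots> \<circ> update f s\<^sub>1\<close>.\<close>

definition updates :: "('z, 'q) network \<Rightarrow> 'z set list \<Rightarrow> ('z, 'q) network" where
  "updates f ss = fold (update f) ss"

definition locally_commutative :: "('z, 'q) network \<Rightarrow> bool" where
  "locally_commutative f \<longleftrightarrow> (\<forall>i j. updates f [{i}, {j}] = updates f [{j}, {i}])"

definition globally_commutative :: "('z, 'q) network \<Rightarrow> bool" where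
  "globally_commutative f \<longleftrightarrow> (\<forall>s t. updates f [s, t] = updates f [t, s])"

definition prop_ICi :: "('z, 'q) network \<Rightarrow> bool" where
  "prop_ICi f \<longleftrightarrow> (\<forall>i j. updates f [{i}, {j}] = update f {i, j})"

definition prop_ICb :: "('z, 'q) network \<Rightarrow> bool" where
  "prop_ICb f \<longleftrightarrow> (\<forall>b c. finite b \<longrightarrow> finite c \<longrightarrow> updates f [b, c] = update f (b \<union> c))"

definition prop_ICs :: "('z, 'q) network \<Rightarrow> bool" where
  "prop_ICs f \<longleftrightarrow> (\<forall>s t. updates f [s, t] = update f (s \<union> t))"

definition prop_I :: "('z, 'q) network \<Rightarrow> bool" where
  "prop_I f \<longleftrightarrow> f \<circ> f = f"

definition prop_Ii :: "('z, 'q) network \<Rightarrow> bool" where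
  "prop_Ii f \<longleftrightarrow> (\<forall>i. update f {i} \<circ> update f {i} = update f {i})"

definition prop_Ib :: "('z, 'q) network \<Rightarrow> bool" where
  "prop_Ib f \<longleftrightarrow> (\<forall>b. finite b \<longrightarrow> update f b \<circ> update f b = update f b)"

definition prop_Is :: "('z, 'q) network \<Rightarrow> bool" where
  "prop_Is f \<longleftrightarrow> (\<forall>s. update f s \<circ> update f s = update f s)"

definition pi_lcm :: "nat \<Rightarrow> nat" where
  "pi_lcm q = Lcm {1..q}"

definition prop_D :: "('z, 'q::finite) network \<Rightarrow> bool" where
  "prop_D f \<longleftrightarrow> f ^^ (pi_lcm CARD('q) + CARD('q) - 1) = f ^^ (CARD('q) - 1)"

definition prop_Ds :: "('z, 'q::finite) network \<Rightarrow> bool" where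
  "prop_Ds f \<longleftrightarrow> (\<forall>s. update f s ^^ (pi_lcm CARD('q) + CARD('q) - 1)
                       = update f s ^^ (CARD('q) - 1))"

end

theory Submission imports Defs "HOL-Library.Countable_Set" begin

text \<open>
  Under global commutativity \<open>f\<^sub>i\<close> is unaffected by updates of sets avoiding \<open>i\<close>, so the update of a
  set splits into updates of disjoint parts; each idempotence property then says that \<open>f\<^sub>i\<close> is
  invariant under every update. Local commutativity yields the same for finite sets.

  For the counterexamples, let each \<open>f\<^sub>i(x)\<close> be a function of the class of \<open>x\<close> modulo finite changes,
  or \<open>x\<^sub>i\<close> itself on some classes. Such an \<open>f\<close> is locally commutative and satisfies \<open>(Ii)\<close>, while its
  action on the classes is arbitrary. For (4) one coordinate is moreover toggled on a single class,
  which \<open>f\<close> leaves at once.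
\<close>

lemma update_apply: "update f s x z = (if z \<in> s then f x z else x z)"
  by (simp add: update_def override_on_def)

lemma update_singleton: "update f {i} x = x(i := f x i)"
  by (auto simp: update_apply)

lemma updates_pair: "updates f [s, t] = update f t \<circ> update f s"
  by (simp add: updates_def)

subsection \<open>Invariance under updates\<close>

text \<open>At \<open>i\<close>, one order of the two updates leaves \<open>f x i\<close> and the
  other \<open>f (update f s x) i\<close>.\<close>

lemma globally_commutative_disjoint:
  assumes "globally_commutative f" "s \<inter> t = {}" "i \<in> t"
  shows "f (update f s x) i = f x i"
proof -
  have "update f t (update f s x) i = update f s (update f t x) i"
    using assms(1) by (metis globally_commutative_def updates_pair comp_apply)
  then show ?thesis using assms(2,3) by (auto simp: update_apply split: if_splits)
qed

lemma globally_commutative_Un: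
  assumes "globally_commutative f" "s \<inter> t = {}"
  shows "update f (s \<union> t) x = update f t (update f s x)"
  using globally_commutative_disjoint[OF assms] by (auto simp: update_apply)

text \<open>\<open>f\<close> is the update of \<open>s\<close> followed by that of
  \<open>- s\<close>, and the latter cannot affect the components in \<open>s\<close>; so (I) passes
  from \<open>f\<close> to \<open>update f s\<close>.\<close>

lemma globally_commutative_prop_I_imp_prop_Is:
  assumes "globally_commutative f" "prop_I f"
  shows "prop_Is f"
proof -
  have "f (update f s x) i = f x i" if "i \<in> s" for s x i
  proof -
    have "f x = update f (s \<union> - s) x" by (simp add: update_apply fun_eq_iff)
    also have "\<dots> = update f (- s) (update f s x)"
      using assms(1) by (intro globally_commutative_Un) auto
    finally have "f (f x) i = f (update f s x) i"
      using globally_commutative_disjoint[OF assms(1), of "- s" s i] that by simp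
    moreover have "f (f x) = f x" using assms(2) by (metis prop_I_def comp_apply)
    ultimately show ?thesis by simp
  qed
  then show ?thesis by (auto simp: prop_Is_def update_apply fun_eq_iff)
qed

lemma prop_Ii_iff: "prop_Ii f \<longleftrightarrow> (\<forall>x i. f (x(i := f x i)) i = f x i)"
proof -
  have "update f {i} (update f {i} x) = update f {i} x \<longleftrightarrow> f (x(i := f x i)) i = f x i" for x i
    by (auto simp: update_singleton dest: fun_upd_eqD)
  then show ?thesis by (auto simp: prop_Ii_def fun_eq_iff[of "_ \<circ> _"])
qed

text \<open>For \<open>i\<close> in \<open>s\<close>, update \<open>{i}\<close> first: (Ii) covers
  that step, and the rest of \<open>s\<close> avoids \<open>i\<close>.\<close>

lemma globally_commutative_prop_Ii_invariant:
  assumes "globally_commutative f" "prop_Ii f"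
  shows "f (update f s x) i = f x i"
proof (cases "i \<in> s")
  case True
  have "update f s x = update f ({i} \<union> (s - {i})) x"
    using True by (simp add: insert_absorb)
  also have "\<dots> = update f (s - {i}) (update f {i} x)"
    using assms(1) by (intro globally_commutative_Un) auto
  finally have "f (update f s x) i = f (update f {i} x) i"
    using globally_commutative_disjoint[OF assms(1), of "s - {i}" "{i}" i] by simp
  then show ?thesis using assms(2) by (simp add: prop_Ii_iff update_singleton)
next
  case False
  then show ?thesis using globally_commutative_disjoint[OF assms(1), of s "{i}" i] by simp
qed

lemma updates_eq_update_UnI:
  assumes "\<And>x i. f (update f s x) i = f x i"
  shows "updates f [s, t] = update f (s \<union> t)"
  using assms by (auto simp: updates_pair update_apply fun_eq_iff)

lemma prop_ICs_imp_prop_Is: "prop_ICs f \<Longrightarrow> prop_Is f"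
  unfolding prop_ICs_def prop_Is_def by (metis updates_pair Un_absorb)

lemma prop_Is_imp_prop_Ii: "prop_Is f \<Longrightarrow> prop_Ii f"
  by (simp add: prop_Is_def prop_Ii_def)

lemma prop_Is_imp_prop_I:
  assumes "prop_Is f"
  shows "prop_I f"
proof -
  have "update f UNIV = f" by (simp add: update_apply fun_eq_iff)
  then show ?thesis using assms by (metis prop_Is_def prop_I_def)
qed

lemma globally_commutative_equivalences:
  assumes "globally_commutative f"
  shows "(prop_I f \<longleftrightarrow> prop_Ii f) \<and> (prop_Ii f \<longleftrightarrow> prop_Is f) \<and> (prop_Is f \<longleftrightarrow> prop_ICs f)"
proof -
  have "prop_Ii f \<Longrightarrow> prop_ICs f"
    unfolding prop_ICs_def
    by (intro allI updates_eq_update_UnI globally_commutative_prop_Ii_invariant[OF assms])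
  then show ?thesis
    using globally_commutative_prop_I_imp_prop_Is[OF assms] prop_ICs_imp_prop_Is
      prop_Is_imp_prop_Ii prop_Is_imp_prop_I by blast
qed

section \<open>Local commutativity and finite sets\<close>

lemma locally_commutative_iff:
  fixes f :: "('z, 'q) network"
  shows
  "locally_commutative f \<longleftrightarrow> (\<forall>x i j. i \<noteq> j \<longrightarrow> f (x(j := f x j)) i = f x i)"
  (is "_ \<longleftrightarrow> ?R")
proof
  assume L: "locally_commutative f"
  show ?R
  proof (intro allI impI)
    fix x :: "'z \<Rightarrow> 'q" and i j :: 'z assume "i \<noteq> j"
    have "update f {i} (update f {j} x) i = update f {j} (update f {i} x) i"
      using L by (metis locally_commutative_def updates_pair comp_apply)
    then show "f (x(j := f x j)) i = f x i"
      using \<open>i \<noteq> j\<close> by (simp add: update_singleton)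
  qed
next
  assume R: ?R
  have "updates f [{i}, {j}] x = updates f [{j}, {i}] x" for i j x
    using R by (cases "i = j") (auto simp: updates_pair update_singleton fun_upd_twist)
  then show "locally_commutative f"
    by (simp add: locally_commutative_def fun_eq_iff)
qed

text \<open>A finite set can be updated one coordinate at a time.\<close>

lemma locally_commutative_prop_Ii_invariant:
  assumes "locally_commutative f" "prop_Ii f" "finite b"
  shows "f (update f b x) i = f x i"
  using assms(3)
proof (induction b arbitrary: i)
  case empty
  show ?case by (simp add: update_def)
next
  case (insert j b)
  \<comment> \<open>Local commutativity covers \<open>k \<noteq> j\<close>, idempotence covers
    \<open>k = j\<close>.\<close>
  have step: "f (update f {j} y) k = f y k" for y k
    using assms(1,2) by (cases "k = j") (auto simp: locally_commutative_iff prop_Ii_iff update_singleton)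
  have "update f (insert j b) x = update f {j} (update f b x)"
    using insert.IH by (simp add: update_singleton) (simp add: update_apply fun_eq_iff)
  then show ?case using step insert.IH by simp
qed

lemma locally_commutative_equivalences:
  assumes "locally_commutative f"
  shows "(prop_Ii f \<longleftrightarrow> prop_ICi f) \<and> (prop_ICi f \<longleftrightarrow> prop_Ib f) \<and> (prop_Ib f \<longleftrightarrow> prop_ICb f)"
proof -
  have "prop_Ii f \<Longrightarrow> prop_ICb f"
    unfolding prop_ICb_def
    by (intro allI impI updates_eq_update_UnI locally_commutative_prop_Ii_invariant[OF assms])
  moreover have "prop_ICb f \<Longrightarrow> prop_Ib f"
    unfolding prop_ICb_def prop_Ib_def updates_pair by simp
  moreover have "prop_ICb f \<Longrightarrow> prop_ICi f"
    unfolding prop_ICb_def prop_ICi_def by (simp add: insert_commute)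
  moreover have "prop_ICi f \<Longrightarrow> prop_Ii f"
    unfolding prop_ICi_def prop_Ii_def updates_pair by (metis insert_absorb2)
  moreover have "prop_Ib f \<Longrightarrow> prop_Ii f"
    by (simp add: prop_Ib_def prop_Ii_def)
  ultimately show ?thesis by blast
qed

subsection \<open>Counterexamples to the remaining implications\<close>

text \<open>Iterates have period 2 from exponent 1 on, and \<open>CARD('q) \<ge> 2\<close> makes
  \<open>pi_lcm CARD('q)\<close> even and \<open>CARD('q) - 1\<close> positive.\<close>

lemma funpow_3_eq_imp_prop_Ds:
  fixes f :: "('z, 'q::finite) network"
  assumes "CARD('q) \<ge> 2" "\<And>s x. update f s (update f s (update f s x)) = update f s x"
  shows "prop_Ds f"
  unfolding prop_Ds_def
proof
  fix s
  let ?g = "update f s"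
  have period: "?g ^^ (2 * k + Suc m) = ?g ^^ Suc m" for k m
    by (induction k) (use assms(2) in \<open>simp_all add: fun_eq_iff\<close>)
  have "2 dvd pi_lcm CARD('q)"
    using assms(1) by (auto simp: pi_lcm_def intro!: dvd_Lcm)
  then obtain k where k: "pi_lcm CARD('q) = 2 * k" by blast
  obtain m where m: "CARD('q) = Suc (Suc m)"
    using assms(1) by (metis Suc_le_D numeral_2_eq_2 Suc_le_mono)
  show "?g ^^ (pi_lcm CARD('q) + CARD('q) - 1) = ?g ^^ (CARD('q) - 1)"
    using period[of k m] unfolding m k[unfolded m] by simp
qed

lemma pi_lcm_pos: "pi_lcm q > 0"
  unfolding pi_lcm_def by (rule Nat.gr0I) (simp add: Lcm_0_iff)

text \<open>Finite updates never alter this property, infinite ones may; the counterexamples exploit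
  that gap.\<close>

definition almost_const :: "'q \<Rightarrow> 'z set \<Rightarrow> ('z \<Rightarrow> 'q) \<Rightarrow> bool" where
  "almost_const a A x \<longleftrightarrow> finite {z \<in> A. x z \<noteq> a}"

lemma almost_const_finite_change:
  assumes "finite s" "\<And>z. z \<notin> s \<Longrightarrow> x z = y z"
  shows "almost_const a A x \<longleftrightarrow> almost_const a A y"
proof -
  have "finite {z \<in> A. x z \<noteq> a}" if "finite {z \<in> A. y z \<noteq> a}" "\<And>z. z \<notin> s \<Longrightarrow> x z = y z" for x y
    by (rule finite_subset[of _ "{z \<in> A. y z \<noteq> a} \<union> s"]) (use that assms(1) in auto)
  from this[of y x] this[of x y] show ?thesis
    using assms(2) unfolding almost_const_def by auto
qed

lemma almost_const_fun_upd [simp]: "almost_const a A (x(j := v)) \<longleftrightarrow> almost_const a A x"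
  by (rule almost_const_finite_change[of "{j}"]) auto

lemma almost_const_update_finite:
  "finite s \<Longrightarrow> almost_const a A (update f s x) \<longleftrightarrow> almost_const a A x"
  by (rule almost_const_finite_change[of s]) (auto simp: update_apply)

lemma not_almost_constI:
  assumes "infinite s" "s \<subseteq> A" "\<And>z. z \<in> s \<Longrightarrow> x z \<noteq> a"
  shows "\<not> almost_const a A x"
proof -
  have "s \<subseteq> {z \<in> A. x z \<noteq> a}" using assms(2,3) by blast
  then show ?thesis using assms(1) finite_subset unfolding almost_const_def by blast
qed

lemma almost_constI: "(\<And>z. z \<in> A \<Longrightarrow> x z = a) \<Longrightarrow> almost_const a A x"
  by (auto simp: almost_const_def intro: finite_subset[of _ "{}"])

text \<open>A bijection with the naturals followed by unpairing arranges \<open>'z\<close> as an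
  infinite grid, whose rows are the fibres.\<close>

lemma countable_infinite_fibres:
  assumes "infinite (UNIV :: 'z::countable set)"
  obtains row :: "'z::countable \<Rightarrow> nat" where "\<And>n. infinite (row -` {n})"
proof -
  obtain h :: "'z \<Rightarrow> nat" where h: "bij h"
    using to_nat_on_infinite[OF _ assms] by auto
  have "infinite ((fst \<circ> prod_decode \<circ> h) -` {n})" for n
  proof
    assume "finite ((fst \<circ> prod_decode \<circ> h) -` {n})"
    moreover have "range (\<lambda>m. inv h (prod_encode (n, m))) \<subseteq> (fst \<circ> prod_decode \<circ> h) -` {n}"
      using h by (auto simp: bij_is_surj surj_f_inv_f)
    moreover have "inj (\<lambda>m. inv h (prod_encode (n, m)))"
      using h by (auto intro!: injI dest!: injD[OF bij_is_inj[OF bij_imp_bij_inv]])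
    ultimately show False
      using finite_subset range_inj_infinite by blast
  qed
  then show thesis by (rule that)
qed

text \<open>With infinitely many infinite rows, the class of a configuration modulo finite changes
  can encode any natural number, although \<open>'q\<close> is finite.\<close>

locale row_network =
  fixes row :: "'z \<Rightarrow> nat" and a b :: "'q::finite"
  assumes infinite_row: "infinite (row -` {n})" and ab: "a \<noteq> b"
begin

definition row_config :: "nat \<Rightarrow> 'z \<Rightarrow> 'q" where
  "row_config n z = (if row z = n then b else a)"

text \<open>If no row is almost constantly \<open>b\<close>, the value is an unspecified number, but still independent
  of finite changes of \<open>x\<close>.\<close>

definition active_row :: "('z \<Rightarrow> 'q) \<Rightarrow> nat" where
  "active_row x = (LEAST n. almost_const b (row -` {n}) x)"

lemma active_row_fun_upd [simp]: "active_row (x(j := v)) = active_row x"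
  by (simp add: active_row_def)

lemma almost_const_row_config:
  "almost_const c (row -` {m}) (row_config n) \<longleftrightarrow> c = (if m = n then b else a)"
proof (cases "c = (if m = n then b else a)")
  case True
  then show ?thesis by (auto simp: row_config_def intro!: almost_constI)
next
  case False
  then show ?thesis
    using not_almost_constI[OF infinite_row[of m] subset_refl, of "row_config n" c]
    by (auto simp: row_config_def)
qed

lemma active_row_row_config [simp]: "active_row (row_config n) = n"
  using ab by (auto simp: active_row_def almost_const_row_config intro!: Least_equality)

lemma row_config_eq_iff [simp]: "row_config m = row_config n \<longleftrightarrow> m = n"
  by (metis active_row_row_config)

text \<open>Starting at 1 leaves row \<open>0\<close> free to act as a switch.\<close>

lemma funpow_row_config:
  assumes "\<And>n. n > 0 \<Longrightarrow> g (row_config n) = row_config (Suc n)"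
  shows "(g ^^ k) (row_config 1) = row_config (Suc k)"
  by (induction k) (simp_all add: assms)

lemma funpow_row_config_aperiodic:
  assumes "\<And>n. n > 0 \<Longrightarrow> g (row_config n) = row_config (Suc n)" "q > 0"
  shows "g ^^ (pi_lcm q + q - 1) \<noteq> g ^^ (q - 1)"
proof
  assume "g ^^ (pi_lcm q + q - 1) = g ^^ (q - 1)"
  then have "row_config (Suc (pi_lcm q + q - 1)) = row_config (Suc (q - 1))"
    using funpow_row_config[of g, OF assms(1)] by metis
  \<comment> \<open>The exponents differ because \<open>pi_lcm q\<close> is positive;
    \<open>q > 0\<close> rules out truncation in the subtractions.\<close>
  then show False
    using pi_lcm_pos[of q] assms(2) by simp
qed

text \<open>The network sees only the active row, and acts on the \<open>row_config n\<close> as the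
  successor function, so orbits never repeat.\<close>

lemma prop_Ii_not_prop_D:
  "\<exists>f :: ('z, 'q) network. locally_commutative f \<and> prop_Ii f \<and> \<not> prop_D f"
proof (intro exI conjI)
  let ?f = "\<lambda>x. row_config (Suc (active_row x))"
  show "locally_commutative ?f" "prop_Ii ?f"
    by (simp_all add: locally_commutative_iff prop_Ii_iff)
  show "\<not> prop_D ?f"
    unfolding prop_D_def by (rule funpow_row_config_aperiodic) simp_all
qed

text \<open>Row \<open>0\<close> is a switch: while it is almost constantly \<open>a\<close>, the other rows run through the
  \<open>row_config n\<close>; updating row \<open>0\<close> as well turns the network into the identity.\<close>

lemma prop_Ii_prop_I_not_prop_Ds:
  "\<exists>f :: ('z, 'q) network. locally_commutative f \<and> prop_Ii f \<and> prop_I f \<and> \<not> prop_Ds f"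
proof (intro exI conjI)
  let ?f = "\<lambda>x. if almost_const a (row -` {0}) x
    then (\<lambda>z. if row z = 0 then b else row_config (Suc (active_row x)) z) else x"
  show "locally_commutative ?f" "prop_Ii ?f"
    by (simp_all add: locally_commutative_iff prop_Ii_iff)
  have "\<not> almost_const a (row -` {0}) (\<lambda>z. if row z = 0 then b else y z)" for y
    using not_almost_constI[OF infinite_row[of 0] subset_refl, of "\<lambda>z. if row z = 0 then b else y z" a] ab by auto
  then show "prop_I ?f"
    by (auto simp: prop_I_def fun_eq_iff)
  \<comment> \<open>For \<open>n > 0\<close> row \<open>0\<close> of \<open>row_config n\<close> is
    constantly \<open>a\<close>, and it is not updated here, so the switch stays on.\<close>
  have "update ?f (- (row -` {0})) (row_config n) = row_config (Suc n)" if "n > 0" for n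
    using that by (auto simp: fun_eq_iff update_apply almost_const_row_config)
      (auto simp: row_config_def)
  then have "update ?f (- (row -` {0})) ^^ (pi_lcm CARD('q) + CARD('q) - 1)
      \<noteq> update ?f (- (row -` {0})) ^^ (CARD('q) - 1)"
    by (rule funpow_row_config_aperiodic) simp_all
  then show "\<not> prop_Ds ?f"
    unfolding prop_Ds_def by blast
qed

lemma prop_Is_not_globally_commutative:
  "\<exists>f :: ('z, 'q) network. locally_commutative f \<and> prop_Is f \<and> \<not> globally_commutative f"
proof (intro exI conjI)
  let ?f = "\<lambda>x :: 'z \<Rightarrow> 'q. if almost_const a UNIV x then (\<lambda>z. b) else x"
  show "locally_commutative ?f"
    by (simp add: locally_commutative_iff)
  have "update ?f s (update ?f s x) = update ?f s x" for s and x :: "'z \<Rightarrow> 'q"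
  \<comment> \<open>An infinite update leaves the almost-\<open>a\<close> class and then freezes;
    otherwise the class is preserved and the same values are rewritten.\<close>
  proof (cases "almost_const a UNIV x \<and> infinite s")
    case True
    then have "\<not> almost_const a UNIV (update ?f s x)"
      using ab by (intro not_almost_constI[of s]) (auto simp: update_apply)
    then show ?thesis by (simp add: update_apply fun_eq_iff)
  next
    case False
    then have "almost_const a UNIV (update ?f s x) \<longleftrightarrow> almost_const a UNIV x"
      by (cases "finite s") (simp add: almost_const_update_finite, simp add: update_apply[abs_def])
    then show ?thesis by (simp add: update_apply fun_eq_iff)
  qed
  then show "prop_Is ?f"
    unfolding prop_Is_def by (intro allI ext) (simp only: comp_apply)
  \<comment> \<open>From constant \<open>a\<close>, whichever row is updated first becomes
    \<open>b\<close> and everything freezes, so the order matters.\<close>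
  have upd: "update ?f (row -` {n}) (\<lambda>z. a) = row_config n" for n
    by (auto simp: update_apply fun_eq_iff row_config_def almost_constI)
  have fixed: "update ?f s (row_config n) = row_config n" for s n
    using not_almost_constI[OF infinite_row subset_UNIV, of n "row_config n" a] ab
    by (auto simp: update_apply fun_eq_iff row_config_def)
  show "\<not> globally_commutative ?f"
  proof
    assume "globally_commutative ?f"
    then have "updates ?f [row -` {0}, row -` {1}] (\<lambda>z. a) = updates ?f [row -` {1}, row -` {0}] (\<lambda>z. a)"
      unfolding globally_commutative_def by metis
    then show False by (simp add: updates_pair upd fixed)
  qed
qed

end

section \<open>Counterexamples over an arbitrary infinite index set\<close>

lemma prop_I_prop_Ds_not_prop_Ii:
  assumes "infinite (UNIV :: 'z set)" "CARD('q::finite) \<ge> 2" "(a :: 'q) \<noteq> b"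
  shows "\<exists>f :: ('z, 'q) network. locally_commutative f \<and> prop_I f \<and> prop_Ds f \<and> \<not> prop_Ii f"
proof -
  fix i :: 'z
  show ?thesis
  proof (intro exI conjI)
    \<comment> \<open>Toggling \<open>i\<close> on almost-\<open>a\<close> configurations breaks
      (Ii); the value \<open>b\<close> elsewhere makes every infinite update leave that
      class.\<close>
    let ?f = "\<lambda>x. if almost_const a UNIV x
      then (\<lambda>z. if z = i \<and> x i = b then a else b) else x"
    have leave: "\<not> almost_const a UNIV y" if "infinite s" "\<And>z. z \<in> s \<Longrightarrow> z \<noteq> i \<Longrightarrow> y z = b" for s y
      using not_almost_constI[of "s - {i}" UNIV y a] that assms(3) by auto
    show "locally_commutative ?f"
      by (auto simp: locally_commutative_iff)
    show "prop_I ?f"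
      using leave[OF assms(1)] by (auto simp: prop_I_def fun_eq_iff)
    show "\<not> prop_Ii ?f"
      using assms(3) by (auto simp: prop_Ii_iff almost_constI intro!: exI[of _ "\<lambda>z. a"] exI[of _ i])
    show "prop_Ds ?f"
    proof (rule funpow_3_eq_imp_prop_Ds[OF assms(2)])
      fix s x
      let ?g = "update ?f s"
      show "?g (?g (?g x)) = ?g x"
      proof (cases "almost_const a UNIV (?g x)")
        case False
        then have "?g (?g x) = ?g x" by (simp add: update_apply fun_eq_iff)
        then show ?thesis by simp
      next
        case True
        have "almost_const a UNIV x"
        proof (rule ccontr)
          assume "\<not> almost_const a UNIV x"
          then have "?g x = x" by (simp add: update_apply fun_eq_iff)
          with True \<open>\<not> almost_const a UNIV x\<close> show False by simp
        qed
        with True leave[of s "?g x"] have "finite s"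
          by (auto simp: update_apply)
        \<comment> \<open>Since the class persists, coordinates of \<open>s\<close> other than
          \<open>i\<close> stay at \<open>b\<close>, while \<open>i\<close>, if in \<open>s\<close>,
          alternates.\<close>
        then have "almost_const a UNIV (?g y) = almost_const a UNIV y" for y
          by (rule almost_const_update_finite)
        then show ?thesis
          using True assms(3) by (simp add: fun_eq_iff update_apply)
      qed
    qed
  qed
qed

lemma prop_Ii_prop_Ds_not_prop_I:
  assumes "infinite (UNIV :: 'z set)" "CARD('q::finite) \<ge> 2" "(a :: 'q) \<noteq> b"
  shows "\<exists>f :: ('z, 'q) network. locally_commutative f \<and> prop_Ii f \<and> prop_Ds f \<and> \<not> prop_I f"
proof (intro exI conjI)
  \<comment> \<open>Swapping the two constant configurations breaks (I); dependence on the class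
    alone gives (Ii).\<close>
  let ?f = "\<lambda>(x :: 'z \<Rightarrow> 'q) (z :: 'z). if almost_const a UNIV x then b else a"
  show "locally_commutative ?f" "prop_Ii ?f"
    by (simp_all add: locally_commutative_iff prop_Ii_iff)
  have a: "almost_const a UNIV (\<lambda>z :: 'z. a)" by (simp add: almost_constI)
  have b: "\<not> almost_const a UNIV (\<lambda>z :: 'z. b)"
    using not_almost_constI[OF assms(1) subset_UNIV, of "\<lambda>z. b" a] assms(3) by auto
  have "?f (?f (\<lambda>z. a)) \<noteq> ?f (\<lambda>z. a)"
    using a b assms(3) by (simp add: fun_eq_iff)
  then show "\<not> prop_I ?f"
    unfolding prop_I_def by (metis comp_apply)
  show "prop_Ds ?f"
  proof (rule funpow_3_eq_imp_prop_Ds[OF assms(2)])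
    fix s and x :: "'z \<Rightarrow> 'q"
    let ?g = "update ?f s"
    \<comment> \<open>From the first step on, every iterate of \<open>x\<close> is
      \<open>A a\<close> or \<open>A b\<close>.\<close>
    define A where "A c = override_on x (\<lambda>z. c) s" for c
    have gx: "?g x = A (if almost_const a UNIV x then b else a)"
      by (simp add: A_def update_def)
    have gA: "?g (A c) = A (if almost_const a UNIV (A c) then b else a)" for c
      by (auto simp: A_def update_apply override_on_def fun_eq_iff)
    show "?g (?g (?g x)) = ?g x"
    proof (cases "finite s")
      case True
      then have "almost_const a UNIV (A c) = almost_const a UNIV x" for c
        by (intro almost_const_finite_change[of s]) (auto simp: A_def override_on_def)
      then show ?thesis by (simp add: gx gA)
    next
      case False
      have "\<not> almost_const a UNIV (A b)"
        using not_almost_constI[OF False, of UNIV "A b" a] assms(3)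
        by (auto simp: A_def override_on_def)
      \<comment> \<open>For other \<open>x\<close>, \<open>?g x = A a\<close>, and either class of
        \<open>A a\<close> leads back to \<open>A a\<close> after two more steps.\<close>
      moreover have "almost_const a UNIV (A a)" if "almost_const a UNIV x"
        using that unfolding almost_const_def
        by (rule rev_finite_subset) (auto simp: A_def override_on_def)
      ultimately show ?thesis by (simp add: gx gA)
    qed
  qed
qed

theorem theorem5:
  assumes "CARD('q::finite) \<ge> 2"
  shows
   "(\<forall>f :: ('z::countable, 'q) network. globally_commutative f \<longrightarrow>
        (prop_I f \<longleftrightarrow> prop_Ii f) \<and> (prop_Ii f \<longleftrightarrow> prop_Is f) \<and> (prop_Is f \<longleftrightarrow> prop_ICs f)) \<and>
    (\<forall>f :: ('z, 'q) network. locally_commutative f \<longrightarrow>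
        (prop_Ii f \<longleftrightarrow> prop_ICi f) \<and> (prop_ICi f \<longleftrightarrow> prop_Ib f) \<and> (prop_Ib f \<longleftrightarrow> prop_ICb f)) \<and>
    (infinite (UNIV :: 'z set) \<longrightarrow>
        (\<exists>f :: ('z, 'q) network. locally_commutative f \<and> prop_Ii f \<and> \<not> prop_D f) \<and>
        (\<exists>f :: ('z, 'q) network. locally_commutative f \<and> prop_I f \<and> prop_Ds f \<and> \<not> prop_Ii f) \<and>
        (\<exists>f :: ('z, 'q) network. locally_commutative f \<and> prop_Ii f \<and> prop_I f \<and> \<not> prop_Ds f) \<and>
        (\<exists>f :: ('z, 'q) network. locally_commutative f \<and> prop_Ii f \<and> prop_Ds f \<and> \<not> prop_I f) \<and>
        (\<exists>f :: ('z, 'q) network. locally_commutative f \<and> prop_Is f \<and> \<not> globally_commutative f))"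
proof (intro conjI impI)
  obtain a b :: 'q where ab: "a \<noteq> b"
    using assms card_le_Suc0_iff_eq[of "UNIV :: 'q set"] by fastforce
  \<comment> \<open>Over a finite index set there is only one class modulo finite changes; the
    constructions rely on \<open>'z\<close> being infinite.\<close>
  assume inf: "infinite (UNIV :: 'z set)"
  obtain row :: "'z \<Rightarrow> nat" where "\<And>n. infinite (row -` {n})"
    using countable_infinite_fibres[OF inf] by blast
  then interpret row_network row a b
    using ab by unfold_locales
  show "\<exists>f :: ('z, 'q) network. locally_commutative f \<and> prop_Ii f \<and> \<not> prop_D f"
    by (rule prop_Ii_not_prop_D)
  show "\<exists>f :: ('z, 'q) network. locally_commutative f \<and> prop_I f \<and> prop_Ds f \<and> \<not> prop_Ii f"
    by (rule prop_I_prop_Ds_not_prop_Ii[OF inf assms ab])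
  show "\<exists>f :: ('z, 'q) network. locally_commutative f \<and> prop_Ii f \<and> prop_I f \<and> \<not> prop_Ds f"
    by (rule prop_Ii_prop_I_not_prop_Ds)
  show "\<exists>f :: ('z, 'q) network. locally_commutative f \<and> prop_Ii f \<and> prop_Ds f \<and> \<not> prop_I f"
    by (rule prop_Ii_prop_Ds_not_prop_I[OF inf assms ab])
  show "\<exists>f :: ('z, 'q) network. locally_commutative f \<and> prop_Is f \<and> \<not> globally_commutative f"
    by (rule prop_Is_not_globally_commutative)
qed (use globally_commutative_equivalences locally_commutative_equivalences in blast)+

end
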